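(* The geodesic equations of the Fisher-Rao metric $g^F$ on the space of beta distributions, for curves $t\mapsto(\alpha(t),\beta(t))\in(0,\infty)\times(0,\infty)$, are $$\ddot\alpha+a(\alpha,\beta)\dot\alpha^2+b(\alpha,\beta)\dot\alpha\dot\beta+c(\alpha,\beta)\dot\beta^2=0,$$ $$\ddot\beta+a(\beta,\alpha)\dot\beta^2+b(\beta,\alpha)\dot\alpha\dot\beta+c(\beta,\alpha)\dot\alpha^2=0,$$ where, for $x,y>0$, $$a(x,y)=\frac{1}{2d(x,y)}\big(\psi''(x)\psi'(y)-\psi''(x)\psi'(x+y)-\psi'(y)\psi''(x+y)\big),$$ $$b(x,y)=-\frac{1}{d(x,y)}\psi'(y)\psi''(x+y),$$ $$c(x,y)=\frac{1}{2d(x,y)}\big(\psi''(y)\psi'(x+y)-\psi'(y)\psi''(x+y)\big),$$ $$d(x,y)=\psi'(x)\psi'(y)-\psi'(x+y)\big(\psi'(x)+\psi'(y)\big).$$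
   Context: $\psi(x)=\frac{d}{dx}\ln\Gamma(x)$ is the digamma function and $\psi',\psi''$ are its first and second derivatives. The Fisher-Rao metric on the parameter space $(0,\infty)\times(0,\infty)$ of the beta distributions $B(\alpha,\beta)$ (density $\frac{\Gamma(\alpha+\beta)}{\Gamma(\alpha)\Gamma(\beta)}x^{\alpha-1}(1-x)^{\beta-1}$ on $[0,1]$) is the Riemannian metric with matrix, in the coordinates $(\alpha,\beta)$, $$g^F(\alpha,\beta)=\begin{pmatrix}\psi'(\alpha)-\psi'(\alpha+\beta) & -\psi'(\alpha+\beta)\\ -\psi'(\alpha+\beta) & \psi'(\beta)-\psi'(\alpha+\beta)\end{pmatrix}.$$ Dots denote derivatives with respect to $t$. *)

theory Defs
  imports "HOL-Analysis.Analysis"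
begin

text \<open>A metric on an open subset of \<open>\<real>\<^sup>n\<close> is given by its matrix field \<open>g\<close> in the standard
  coordinates; geodesics are the curves with vanishing covariant acceleration with respect
  to the Levi-Civita connection of \<open>g\<close>.\<close>

definition partial_deriv :: "'n::finite \<Rightarrow> (real^'n \<Rightarrow> real) \<Rightarrow> real^'n \<Rightarrow> real" where
  "partial_deriv i f p = deriv (\<lambda>s. f (p + s *\<^sub>R axis i 1)) 0"

text \<open>\<open>christoffel g k i j\<close> is the symbol of the second kind with upper index \<open>k\<close> and
  lower indices \<open>i\<close>, \<open>j\<close>. It is meaningful only where \<open>g p\<close> is invertible.\<close>

definition christoffel ::
    "(real^'n \<Rightarrow> real^'n^'n) \<Rightarrow> 'n::finite \<Rightarrow> 'n \<Rightarrow> 'n \<Rightarrow> real^'n \<Rightarrow> real" where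
  "christoffel g k i j p =
     (1/2) * (\<Sum>l\<in>UNIV. matrix_inv (g p) $ k $ l *
        (partial_deriv i (\<lambda>q. g q $ j $ l) p
         + partial_deriv j (\<lambda>q. g q $ i $ l) p
         - partial_deriv l (\<lambda>q. g q $ i $ j) p))"

definition velocity :: "(real \<Rightarrow> real^'n) \<Rightarrow> real \<Rightarrow> real^'n" where
  "velocity \<gamma> t = vector_derivative \<gamma> (at t)"

definition covariant_acceleration ::
    "(real^'n \<Rightarrow> real^'n^'n) \<Rightarrow> (real \<Rightarrow> real^'n) \<Rightarrow> real \<Rightarrow> real^'n::finite" where
  "covariant_acceleration g \<gamma> t =
     (\<chi> k. vector_derivative (velocity \<gamma>) (at t) $ k
        + (\<Sum>i\<in>UNIV. \<Sum>j\<in>UNIV.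
             christoffel g k i j (\<gamma> t) * velocity \<gamma> t $ i * velocity \<gamma> t $ j))"

definition geodesic_on ::
    "(real^'n) set \<Rightarrow> (real^'n \<Rightarrow> real^'n^'n) \<Rightarrow> real set \<Rightarrow> (real \<Rightarrow> real^'n::finite) \<Rightarrow> bool" where
  "geodesic_on M g T \<gamma> \<longleftrightarrow>
     \<gamma> ` T \<subseteq> M \<and>
     (\<forall>t\<in>T. \<gamma> differentiable (at t) \<and> velocity \<gamma> differentiable (at t)
        \<and> covariant_acceleration g \<gamma> t = 0)"

definition trigamma :: "real \<Rightarrow> real"  ("\<psi>''") where
  "\<psi>' = deriv Digamma"

definition tetragamma :: "real \<Rightarrow> real"  ("\<psi>''''") where
  "\<psi>'' = deriv \<psi>'"

definition beta_params :: "(real^2) set" where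
  "beta_params = {p. p $ 1 > 0 \<and> p $ 2 > 0}"

definition fisher_rao_beta :: "real^2 \<Rightarrow> real^2^2" where
  "fisher_rao_beta p =
     (let \<alpha> = p $ 1; \<beta> = p $ 2 in
      vector [vector [\<psi>' \<alpha> - \<psi>' (\<alpha> + \<beta>), - \<psi>' (\<alpha> + \<beta>)],
              vector [- \<psi>' (\<alpha> + \<beta>), \<psi>' \<beta> - \<psi>' (\<alpha> + \<beta>)]])"

definition coeff_d :: "real \<Rightarrow> real \<Rightarrow> real" where
  "coeff_d x y = \<psi>' x * \<psi>' y - \<psi>' (x + y) * (\<psi>' x + \<psi>' y)"

definition coeff_a :: "real \<Rightarrow> real \<Rightarrow> real" where
  "coeff_a x y = 1 / (2 * coeff_d x y) *
     (\<psi>'' x * \<psi>' y - \<psi>'' x * \<psi>' (x + y) - \<psi>' y * \<psi>'' (x + y))"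

definition coeff_b :: "real \<Rightarrow> real \<Rightarrow> real" where
  "coeff_b x y = - (1 / coeff_d x y) * (\<psi>' y * \<psi>'' (x + y))"

definition coeff_c :: "real \<Rightarrow> real \<Rightarrow> real" where
  "coeff_c x y = 1 / (2 * coeff_d x y) *
     (\<psi>'' y * \<psi>' (x + y) - \<psi>' y * \<psi>'' (x + y))"

end

theory Submission
  imports Defs "HOL-Real_Asymp.Real_Asymp"
begin

text \<open>
  The metric is the Hessian of \<open>ln \<Gamma>(\<alpha>) + ln \<Gamma>(\<beta>) - ln \<Gamma>(\<alpha> + \<beta>)\<close>, so \<open>\<partial>\<^sub>i g\<^sub>j\<^sub>l\<close> is a third derivative of
  one function and is symmetric in all three indices. Two of the three derivatives in the
  Christoffel symbol therefore cancel, and \<open>\<Gamma>\<^sup>k\<^sub>i\<^sub>j\<close> is half the sum over \<open>l\<close> of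
  \<open>(g\<inverse>)\<^sup>k\<^sup>l \<partial>\<^sub>i g\<^sub>j\<^sub>l\<close> (lemma \<open>christoffel_fisher_rao_beta\<close>). The determinant of the metric is
  \<open>coeff_d\<close>; the coefficients \<open>a\<close> and \<open>c\<close> are Christoffel symbols with equal lower indices, while \<open>b\<close> is twice a
  mixed one, since the mixed terms occur twice in the geodesic equation. What is left of the
  geometric part is to differentiate a plane curve componentwise.

  The analytic content is that the determinant does not vanish (lemma \<open>coeff_d_pos\<close>). Divided by
  \<open>\<psi>'(x) \<psi>'(y) \<psi>'(x + y)\<close>, positivity of \<open>d(x, y)\<close> says that \<open>1 / \<psi>'\<close> is strictly superadditive. A
  function \<open>f\<close> is strictly superadditive as soon as \<open>f(x) / x\<close> is strictly increasing; here this means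
  that \<open>x \<psi>'(x)\<close> strictly decreases. Its derivative \<open>\<psi>'(x) + x \<psi>''(x)\<close> is shown to be negative by
  comparing the series of \<open>\<psi>'\<close> and \<open>\<psi>''\<close> with telescoping series.
\<close>

section \<open>The trigamma and tetragamma functions\<close>

lemma pos_not_nonpos_Ints: "x \<notin> \<int>\<^sub>\<le>\<^sub>0" if "0 < x" for x :: real
  using that by (auto elim!: nonpos_Ints_cases)

lemma trigamma_eq_Polygamma: "\<psi>' x = Polygamma 1 x" if "0 < x"
  unfolding trigamma_def using deriv_Polygamma[of x 0] pos_not_nonpos_Ints[OF that] by simp

lemma has_field_derivative_trigamma_Polygamma:
  assumes "0 < x"
  shows "(\<psi>' has_field_derivative Polygamma 2 x) (at x)"
proof (rule has_field_derivative_transform_within_open)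
  show "(Polygamma 1 has_field_derivative Polygamma 2 x) (at x)"
    using has_field_derivative_Polygamma[of x 1] pos_not_nonpos_Ints[OF assms]
    by (simp add: numeral_2_eq_2)
  show "open {0::real<..}" "x \<in> {0<..}" using assms by auto
  show "\<And>y. y \<in> {0<..} \<Longrightarrow> Polygamma 1 y = \<psi>' y" by (simp add: trigamma_eq_Polygamma)
qed

lemma tetragamma_eq_Polygamma: "\<psi>'' x = Polygamma 2 x" if "0 < x"
  unfolding tetragamma_def
  using has_field_derivative_trigamma_Polygamma[OF that] by (rule DERIV_imp_deriv)

lemma has_field_derivative_trigamma: "(\<psi>' has_field_derivative \<psi>'' x) (at x)" if "0 < x"
  using has_field_derivative_trigamma_Polygamma[OF that] tetragamma_eq_Polygamma[OF that] by simp

lemma trigamma_sums: "(\<lambda>k. 1 / (x + real k)\<^sup>2) sums \<psi>' x" if "0 < x"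
  using Polygamma_LIMSEQ[of x 1] that
  by (simp add: trigamma_eq_Polygamma inverse_eq_divide power2_eq_square)

lemma tetragamma_sums: "(\<lambda>k. 2 / (x + real k) ^ 3) sums (- \<psi>'' x)" if "0 < x"
  using sums_mult[OF Polygamma_LIMSEQ[of x 2], of 2] that
  by (simp add: tetragamma_eq_Polygamma inverse_eq_divide eval_nat_numeral algebra_simps)

lemma trigamma_pos: "0 < \<psi>' x" if "0 < x"
proof -
  have "0 < (\<Sum>k. 1 / (x + real k)\<^sup>2)"
    using sums_summable[OF trigamma_sums[OF that]] that
    by (intro suminf_pos) (auto intro!: divide_pos_pos zero_less_power add_pos_nonneg)
  then show ?thesis using sums_unique[OF trigamma_sums[OF that]] by simp
qed

lemma trigamma_plus1: "\<psi>' (x + 1) = \<psi>' x - 1 / x\<^sup>2" if "0 < x"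
  using Polygamma_plus1[of x 1] that
  by (simp add: trigamma_eq_Polygamma power2_eq_square)

lemma tetragamma_plus1: "\<psi>'' (x + 1) = \<psi>'' x + 2 / x ^ 3" if "0 < x"
  using Polygamma_plus1[of x 2] that
  by (simp add: tetragamma_eq_Polygamma eval_nat_numeral)

text \<open>Termwise comparison with a telescoping series:
  \<open>1 / m^2 \<le> 1 / (m^2 - 1/4) = 1 / (m - 1/2) - 1 / (m + 1/2)\<close> for \<open>m = x + k\<close>.\<close>

lemma trigamma_le:
  assumes "1/2 < x"
  shows "\<psi>' x \<le> 1 / (x - 1/2)"
proof -
  define f where "f k = 1 / (x + real k - 1/2)" for k
  have "f \<longlonglongrightarrow> 0" unfolding f_def by real_asymp
  from telescope_sums'[OF this] have s: "(\<lambda>k. f k - f (Suc k)) sums (1 / (x - 1/2))"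
    by (simp add: f_def)
  have "1 / (x + real k)\<^sup>2 \<le> f k - f (Suc k)" for k
  proof -
    define m where "m = x + real k"
    have m: "1/2 < m" using assms by (simp add: m_def)
    have "1/2 * (1/2) < m * m" using m by (intro mult_strict_mono) auto
    then have p: "0 < m\<^sup>2 - 1/4" by (simp add: power2_eq_square)
    have "f k - f (Suc k) = 1 / (m - 1/2) - 1 / (m + 1/2)"
      by (simp add: f_def m_def)
    also have "\<dots> = 1 / (m\<^sup>2 - 1/4)"
      using m p by (simp add: field_simps power2_eq_square)
    finally have "f k - f (Suc k) = 1 / (m\<^sup>2 - 1/4)" .
    moreover have "1 / m\<^sup>2 \<le> 1 / (m\<^sup>2 - 1/4)" using p by (intro divide_left_mono mult_pos_pos) auto
    ultimately show ?thesis by (simp add: m_def)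
  qed
  then show ?thesis using assms by (intro sums_le[OF _ trigamma_sums s]) auto
qed

text \<open>The same method, with the factorisation
  \<open>m^4 + 1/4 = (m^2 - m + 1/2) (m^2 + m + 1/2)\<close>. The second factor is the first one at \<open>m + 1\<close>, so
  \<open>2 m / (m^4 + 1/4)\<close> telescopes, and it lies just below the term \<open>2 / m^3\<close> of the series
  of \<open>- \<psi>''(x)\<close>.\<close>

lemma tetragamma_le:
  assumes "0 < x"
  shows "\<psi>'' x \<le> - 1 / (x\<^sup>2 - x + 1/2)"
proof -
  define f where "f k = 1 / ((x + real k)\<^sup>2 - (x + real k) + 1/2)" for k
  have "f \<longlonglongrightarrow> 0" unfolding f_def by real_asymp
  from telescope_sums'[OF this] have s: "(\<lambda>k. f k - f (Suc k)) sums (1 / (x\<^sup>2 - x + 1/2))"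
    by (simp add: f_def)
  have "f k - f (Suc k) \<le> 2 / (x + real k) ^ 3" for k
  proof -
    define m where "m = x + real k"
    have m: "0 < m" using assms by (simp add: m_def)
    have "0 \<le> (m - 1/2)\<^sup>2" by simp
    then have q: "0 < m\<^sup>2 - m + 1/2" by (simp add: power2_eq_square algebra_simps)
    have "f k - f (Suc k) = 1 / (m\<^sup>2 - m + 1/2) - 1 / (m\<^sup>2 + m + 1/2)"
      by (simp add: f_def m_def power2_eq_square algebra_simps)
    also have "\<dots> = 2 * m / ((m\<^sup>2 - m + 1/2) * (m\<^sup>2 + m + 1/2))"
      using m q by (subst diff_frac_eq) (auto simp: add_pos_pos less_imp_neq[symmetric] add_nonneg_eq_0_iff)
    also have "(m\<^sup>2 - m + 1/2) * (m\<^sup>2 + m + 1/2) = m ^ 4 + 1/4"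
      by algebra
    also have "2 * m / (m ^ 4 + 1/4) \<le> 2 * m / m ^ 4"
      using m by (intro divide_left_mono mult_pos_pos) (auto simp: add_pos_pos)
    also have "\<dots> = 2 / m ^ 3" using m by (simp add: eval_nat_numeral)
    finally show ?thesis by (simp add: m_def)
  qed
  then have "1 / (x\<^sup>2 - x + 1/2) \<le> - \<psi>'' x"
    using assms by (intro sums_le[OF _ s tetragamma_sums]) auto
  then show ?thesis by simp
qed

text \<open>The bounds above are too weak near \<open>0\<close>, where the poles of \<open>\<psi>'\<close> and \<open>\<psi>''\<close> dominate. The
  recurrence splits off the polar terms \<open>1 / x^2\<close> and \<open>- 2 / x^3\<close> exactly, and the bounds are applied
  only at \<open>x + 1\<close>. The polar terms contribute \<open>- 1 / x^2\<close> to the left-hand side, which outweighs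
  what the two bounds leave.\<close>

lemma deriv_x_trigamma_neg:
  assumes "0 < x"
  shows "\<psi>' x + x * \<psi>'' x < 0"
proof -
  define u v where "u = x + 1/2" and "v = x\<^sup>2 + x + 1/2"
  have uv: "0 < u" "0 < v" using assms by (auto simp: u_def v_def add_pos_pos)
  have 1: "\<psi>' x \<le> 1 / x\<^sup>2 + 1 / u"
    using trigamma_le[of "x + 1"] trigamma_plus1[OF assms] assms by (simp add: u_def add.commute)
  \<comment> \<open>The denominator in the bound for \<open>\<psi>''\<close> at \<open>x + 1\<close>.\<close>
  have "(x + 1)\<^sup>2 - (x + 1) + 1/2 = v"
    by (simp add: v_def power2_eq_square algebra_simps)
  then have "\<psi>'' x \<le> - (2 / x ^ 3) - 1 / v"
    using tetragamma_le[of "x + 1"] tetragamma_plus1[OF assms] assms by simp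
  then have "x * \<psi>'' x \<le> x * (- (2 / x ^ 3) - 1 / v)"
    using assms by (intro mult_left_mono) auto
  also have "\<dots> = - 2 / x\<^sup>2 - x / v"
    using assms by (simp add: eval_nat_numeral algebra_simps)
  finally have 2: "x * \<psi>'' x \<le> - 2 / x\<^sup>2 - x / v" .
  have "1 / u - x / v < 1 / x\<^sup>2"
  proof -
    have "x\<^sup>2 * (v - x * u) < u * v"
    proof -
      \<comment> \<open>The cubic terms of \<open>u v\<close> and \<open>x^2 (v - x u)\<close> are \<open>x^3\<close> and \<open>x^3 / 2\<close>, since
        \<open>v - x u\<close> is only linear; all lower terms of the difference are positive too.\<close>
      have "u * v - x\<^sup>2 * (v - x * u) = x ^ 3 / 2 + x\<^sup>2 + x + 1/4"
        unfolding u_def v_def by (simp add: eval_nat_numeral algebra_simps)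
      moreover have "0 < x ^ 3 / 2 + x\<^sup>2 + x + 1/4" using assms by (simp add: add_pos_pos)
      ultimately show ?thesis by linarith
    qed
    moreover have "1 / u - x / v = (v - x * u) / (u * v)"
      using uv by (simp add: field_simps)
    ultimately show ?thesis using uv assms by (simp add: field_simps)
  qed
  with 1 2 show ?thesis by simp
qed

lemma x_trigamma_strict_decreasing:
  assumes "0 < x" "x < y"
  shows "y * \<psi>' y < x * \<psi>' x"
proof (rule DERIV_neg_imp_decreasing[OF assms(2)])
  fix z assume "x \<le> z" "z \<le> y"
  then have z: "0 < z" using assms by simp
  have "((\<lambda>z. z * \<psi>' z) has_real_derivative \<psi>' z + z * \<psi>'' z) (at z)"
    using has_field_derivative_trigamma[OF z]
    by (auto intro!: derivative_eq_intros)
  then show "\<exists>D. ((\<lambda>z. z * \<psi>' z) has_real_derivative D) (at z) \<and> D < 0"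
    using deriv_x_trigamma_neg[OF z] by blast
qed

text \<open>By the monotonicity of \<open>z \<psi>'(z)\<close>, the product \<open>(x + y) \<psi>'(x + y)\<close> is smaller than both \<open>x \<psi>'(x)\<close> and
  \<open>y \<psi>'(y)\<close>. Multiplying by \<open>\<psi>'(y)\<close> and \<open>\<psi>'(x)\<close> respectively and adding gives
  \<open>(x + y) \<psi>'(x + y) (\<psi>'(x) + \<psi>'(y)) < (x + y) \<psi>'(x) \<psi>'(y)\<close>.\<close>

lemma coeff_d_pos:
  assumes "0 < x" "0 < y"
  shows "0 < coeff_d x y"
proof -
  have "(x + y) * \<psi>' (x + y) * \<psi>' y < x * \<psi>' x * \<psi>' y"
    using x_trigamma_strict_decreasing[of x "x + y"] trigamma_pos[of y] assms by simp
  moreover have "(x + y) * \<psi>' (x + y) * \<psi>' x < y * \<psi>' y * \<psi>' x"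
    using x_trigamma_strict_decreasing[of y "x + y"] trigamma_pos[of x] assms by simp
  ultimately have "0 < (x + y) * coeff_d x y"
    unfolding coeff_d_def by (simp add: algebra_simps)
  then show ?thesis using assms by (simp add: zero_less_mult_iff)
qed

section \<open>The Levi-Civita connection\<close>

lemma fisher_rao_beta_nth:
  "fisher_rao_beta p $ i $ j = (if i = j then \<psi>' (p $ i) else 0) - \<psi>' (p $ 1 + p $ 2)"
  using exhaust_2[of i] exhaust_2[of j] by (auto simp: fisher_rao_beta_def Let_def)

text \<open>The right-hand side is symmetric in \<open>i\<close>, \<open>j\<close> and \<open>l\<close>, because the metric is a Hessian.\<close>

lemma partial_deriv_fisher_rao_beta:
  assumes "p \<in> beta_params"
  shows "partial_deriv i (\<lambda>q. fisher_rao_beta q $ j $ l) p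
    = (if i = j \<and> j = l then \<psi>'' (p $ i) else 0) - \<psi>'' (p $ 1 + p $ 2)"
proof -
  have pos: "0 < p $ 1" "0 < p $ 2" "0 < p $ j"
    using assms exhaust_2[of j] by (auto simp: beta_params_def)
  let ?q = "\<lambda>s. p + s *\<^sub>R axis i 1"
  have c: "((\<lambda>s. ?q s $ k) has_real_derivative (if i = k then 1 else 0)) (at 0)" for k
    by (auto simp: axis_def intro!: derivative_eq_intros)
  have "((\<lambda>s. ?q s $ 1 + ?q s $ 2) has_real_derivative 1) (at 0)"
    using DERIV_add[OF c[of 1] c[of 2]] exhaust_2[of i] by auto
  from DERIV_chain2[OF _ this] have S:
    "((\<lambda>s. \<psi>' (?q s $ 1 + ?q s $ 2)) has_real_derivative \<psi>'' (p $ 1 + p $ 2)) (at 0)"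
    using has_field_derivative_trigamma[of "p $ 1 + p $ 2"] pos by simp
  have "((\<lambda>s. \<psi>' (?q s $ j)) has_real_derivative \<psi>'' (p $ j) * (if i = j then 1 else 0)) (at 0)"
    by (rule DERIV_chain2[OF _ c]) (simp add: has_field_derivative_trigamma pos)
  then have D: "((\<lambda>s. if j = l then \<psi>' (?q s $ j) else 0) has_real_derivative
      (if i = j \<and> j = l then \<psi>'' (p $ i) else 0)) (at 0)"
    by (cases "i = j"; cases "j = l") auto
  show ?thesis
    unfolding partial_deriv_def fisher_rao_beta_nth
    by (rule DERIV_imp_deriv[OF DERIV_diff[OF D S]])
qed

lemma matrix_inv_fisher_rao_beta:
  assumes "p \<in> beta_params"
  defines "x \<equiv> p $ 1" and "y \<equiv> p $ 2"
  shows "matrix_inv (fisher_rao_beta p) =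
    (vector [vector [(\<psi>' y - \<psi>' (x + y)) / coeff_d x y, \<psi>' (x + y) / coeff_d x y],
             vector [\<psi>' (x + y) / coeff_d x y, (\<psi>' x - \<psi>' (x + y)) / coeff_d x y]] :: real^2^2)"
    (is "_ = ?B")
proof -
  have d: "coeff_d x y \<noteq> 0"
    using assms coeff_d_pos[of x y] by (auto simp: beta_params_def)
  have AB: "fisher_rao_beta p ** ?B = mat 1"
    using d unfolding vec_eq_iff forall_2 matrix_matrix_mult_def mat_def
    by (simp add: sum_2 fisher_rao_beta_nth x_def[symmetric] y_def[symmetric] divide_simps)
      (simp add: coeff_d_def algebra_simps)
  then have BA: "?B ** fisher_rao_beta p = mat 1"
    by (simp add: matrix_left_right_inverse)
  then have "invertible (fisher_rao_beta p)" using AB by (auto simp: invertible_def)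
  then have "fisher_rao_beta p ** matrix_inv (fisher_rao_beta p) = mat 1"
    unfolding invertible_def matrix_inv_def by (rule someI_ex[THEN conjunct1])
  then have "?B ** (fisher_rao_beta p ** matrix_inv (fisher_rao_beta p)) = ?B" by simp
  then show ?thesis by (simp add: matrix_mul_assoc BA)
qed

lemma coeff_d_commute: "coeff_d y x = coeff_d x y"
  by (simp add: coeff_d_def algebra_simps)

lemma christoffel_fisher_rao_beta:
  assumes "p \<in> beta_params"
  defines "x \<equiv> p $ 1" and "y \<equiv> p $ 2"
  shows "christoffel fisher_rao_beta 1 1 1 p = coeff_a x y"
    and "christoffel fisher_rao_beta 1 1 2 p = coeff_b x y / 2"
    and "christoffel fisher_rao_beta 1 2 1 p = coeff_b x y / 2"
    and "christoffel fisher_rao_beta 1 2 2 p = coeff_c x y"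
    and "christoffel fisher_rao_beta 2 1 1 p = coeff_c y x"
    and "christoffel fisher_rao_beta 2 1 2 p = coeff_b y x / 2"
    and "christoffel fisher_rao_beta 2 2 1 p = coeff_b y x / 2"
    and "christoffel fisher_rao_beta 2 2 2 p = coeff_a y x"
proof -
  have d: "coeff_d x y \<noteq> 0"
    using assms coeff_d_pos[of x y] by (auto simp: beta_params_def)
  note rules = christoffel_def sum_2 partial_deriv_fisher_rao_beta[OF assms(1)]
    matrix_inv_fisher_rao_beta[OF assms(1)] x_def[symmetric] y_def[symmetric]
    coeff_a_def coeff_b_def coeff_c_def coeff_d_commute[of y x] add.commute[of y x]
  show "christoffel fisher_rao_beta 1 1 1 p = coeff_a x y"
    and "christoffel fisher_rao_beta 1 1 2 p = coeff_b x y / 2"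
    and "christoffel fisher_rao_beta 1 2 1 p = coeff_b x y / 2"
    and "christoffel fisher_rao_beta 1 2 2 p = coeff_c x y"
    and "christoffel fisher_rao_beta 2 1 1 p = coeff_c y x"
    and "christoffel fisher_rao_beta 2 1 2 p = coeff_b y x / 2"
    and "christoffel fisher_rao_beta 2 2 1 p = coeff_b y x / 2"
    and "christoffel fisher_rao_beta 2 2 2 p = coeff_a y x"
    using d by (simp_all add: rules) (simp_all add: divide_simps, simp_all add: algebra_simps)
qed

section \<open>Curves in the plane\<close>

lemma has_vector_derivative_vector_2:
  assumes "(f has_real_derivative f') (at t)" "(g has_real_derivative g') (at t)"
  shows "((\<lambda>t. vector [f t, g t] :: real^2) has_vector_derivative vector [f', g']) (at t)"
proof -
  have *: "(vector [a, b] :: real^2) = a *\<^sub>R axis 1 1 + b *\<^sub>R axis 2 1" for a b :: real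
    by (simp add: vec_eq_iff forall_2 axis_def)
  show ?thesis
    unfolding * using assms
    by (auto intro!: derivative_eq_intros simp: has_real_derivative_iff_has_vector_derivative)
qed

lemma velocity_vector_2:
  assumes "f differentiable (at t)" "g differentiable (at t)"
  shows "((\<lambda>t. vector [f t, g t] :: real^2) has_vector_derivative vector [deriv f t, deriv g t]) (at t)"
    and "velocity (\<lambda>t. vector [f t, g t] :: real^2) t = vector [deriv f t, deriv g t]"
proof -
  show *: "((\<lambda>t. vector [f t, g t] :: real^2) has_vector_derivative vector [deriv f t, deriv g t]) (at t)"
    using assms by (intro has_vector_derivative_vector_2)
      (auto simp: DERIV_deriv_iff_real_differentiable)
  show "velocity (\<lambda>t. vector [f t, g t] :: real^2) t = vector [deriv f t, deriv g t]"
    unfolding velocity_def by (rule vector_derivative_at[OF *])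
qed

text \<open>The velocity is known only on \<open>T\<close>; since \<open>T\<close> is open, that determines its derivative at \<open>t\<close>.\<close>

lemma acceleration_vector_2:
  assumes "open T" "t \<in> T" "f differentiable_on T" "g differentiable_on T"
    and "deriv f differentiable_on T" "deriv g differentiable_on T"
  shows "(velocity (\<lambda>t. vector [f t, g t] :: real^2) has_vector_derivative
           vector [deriv (deriv f) t, deriv (deriv g) t]) (at t)"
proof (rule has_vector_derivative_transform_within_open[OF _ assms(1,2)])
  show "((\<lambda>t. vector [deriv f t, deriv g t] :: real^2) has_vector_derivative
          vector [deriv (deriv f) t, deriv (deriv g) t]) (at t)"
    using assms by (intro velocity_vector_2) (auto simp: differentiable_on_eq_differentiable_at)
  show "vector [deriv f s, deriv g s] = velocity (\<lambda>t. vector [f t, g t] :: real^2) s"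
    if "s \<in> T" for s
    using assms that
    by (intro velocity_vector_2(2)[symmetric]) (auto simp: differentiable_on_eq_differentiable_at)
qed

lemma covariant_acceleration_fisher_rao_beta:
  assumes T: "open T" "t \<in> T" "\<alpha> differentiable_on T" "\<beta> differentiable_on T"
      "deriv \<alpha> differentiable_on T" "deriv \<beta> differentiable_on T"
    and pos: "0 < \<alpha> t" "0 < \<beta> t"
  shows "covariant_acceleration fisher_rao_beta (\<lambda>t. vector [\<alpha> t, \<beta> t]) t = vector
    [deriv (deriv \<alpha>) t + coeff_a (\<alpha> t) (\<beta> t) * (deriv \<alpha> t)^2
       + coeff_b (\<alpha> t) (\<beta> t) * deriv \<alpha> t * deriv \<beta> t
       + coeff_c (\<alpha> t) (\<beta> t) * (deriv \<beta> t)^2,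
     deriv (deriv \<beta>) t + coeff_a (\<beta> t) (\<alpha> t) * (deriv \<beta> t)^2
       + coeff_b (\<beta> t) (\<alpha> t) * deriv \<alpha> t * deriv \<beta> t
       + coeff_c (\<beta> t) (\<alpha> t) * (deriv \<alpha> t)^2]"
proof -
  have "vector [\<alpha> t, \<beta> t] \<in> beta_params" using pos by (simp add: beta_params_def)
  note christoffel = christoffel_fisher_rao_beta[OF this, unfolded vector_2]
  have "velocity (\<lambda>t. vector [\<alpha> t, \<beta> t] :: real^2) t = vector [deriv \<alpha> t, deriv \<beta> t]"
    using T by (intro velocity_vector_2) (auto simp: differentiable_on_eq_differentiable_at)
  moreover note vector_derivative_at[OF acceleration_vector_2[OF T]]
  ultimately show ?thesis
    unfolding covariant_acceleration_def vec_eq_iff forall_2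
    by (simp add: sum_2 christoffel power2_eq_square algebra_simps)
qed

theorem proposition2:
  shows "(\<forall>x>0. \<forall>y>0. coeff_d x y \<noteq> 0) \<and>
    (\<forall>(T :: real set) (\<alpha> :: real \<Rightarrow> real) (\<beta> :: real \<Rightarrow> real).
      open T \<and> is_interval T \<and>
      (\<forall>t\<in>T. \<alpha> t > 0 \<and> \<beta> t > 0) \<and>
      \<alpha> differentiable_on T \<and> deriv \<alpha> differentiable_on T \<and>
      \<beta> differentiable_on T \<and> deriv \<beta> differentiable_on T \<longrightarrow>
      (geodesic_on beta_params fisher_rao_beta T (\<lambda>t. vector [\<alpha> t, \<beta> t]) \<longleftrightarrow>
       (\<forall>t\<in>T.
         deriv (deriv \<alpha>) t + coeff_a (\<alpha> t) (\<beta> t) * (deriv \<alpha> t)^2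
           + coeff_b (\<alpha> t) (\<beta> t) * deriv \<alpha> t * deriv \<beta> t
           + coeff_c (\<alpha> t) (\<beta> t) * (deriv \<beta> t)^2 = 0 \<and>
         deriv (deriv \<beta>) t + coeff_a (\<beta> t) (\<alpha> t) * (deriv \<beta> t)^2
           + coeff_b (\<beta> t) (\<alpha> t) * deriv \<alpha> t * deriv \<beta> t
           + coeff_c (\<beta> t) (\<alpha> t) * (deriv \<alpha> t)^2 = 0)))"
proof (intro conjI allI impI)
  show "coeff_d x y \<noteq> 0" if "0 < x" "0 < y" for x y
    using coeff_d_pos[OF that] by simp
next
  fix T :: "real set" and \<alpha> \<beta> :: "real \<Rightarrow> real"
  assume "open T \<and> is_interval T \<and>
      (\<forall>t\<in>T. \<alpha> t > 0 \<and> \<beta> t > 0) \<and>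
      \<alpha> differentiable_on T \<and> deriv \<alpha> differentiable_on T \<and>
      \<beta> differentiable_on T \<and> deriv \<beta> differentiable_on T"
  then have T: "open T" "\<alpha> differentiable_on T" "\<beta> differentiable_on T"
      "deriv \<alpha> differentiable_on T" "deriv \<beta> differentiable_on T"
    and pos: "\<And>t. t \<in> T \<Longrightarrow> 0 < \<alpha> t" "\<And>t. t \<in> T \<Longrightarrow> 0 < \<beta> t"
    by auto
  let ?\<gamma> = "\<lambda>t. vector [\<alpha> t, \<beta> t] :: real^2"
  have "?\<gamma> ` T \<subseteq> beta_params" using pos by (auto simp: beta_params_def)
  moreover have "?\<gamma> differentiable (at t)" if "t \<in> T" for t
    using T that by (intro differentiableI_vector[OF velocity_vector_2(1)])
      (auto simp: differentiable_on_eq_differentiable_at)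
  moreover have "velocity ?\<gamma> differentiable (at t)" if "t \<in> T" for t
    using acceleration_vector_2[OF T(1) that T(2-5)] by (rule differentiableI_vector)
  ultimately have "geodesic_on beta_params fisher_rao_beta T ?\<gamma> \<longleftrightarrow>
      (\<forall>t\<in>T. covariant_acceleration fisher_rao_beta ?\<gamma> t = 0)"
    by (auto simp: geodesic_on_def)
  then show "geodesic_on beta_params fisher_rao_beta T ?\<gamma> \<longleftrightarrow>
       (\<forall>t\<in>T.
         deriv (deriv \<alpha>) t + coeff_a (\<alpha> t) (\<beta> t) * (deriv \<alpha> t)^2
           + coeff_b (\<alpha> t) (\<beta> t) * deriv \<alpha> t * deriv \<beta> t
           + coeff_c (\<alpha> t) (\<beta> t) * (deriv \<beta> t)^2 = 0 \<and>
         deriv (deriv \<beta>) t + coeff_a (\<beta> t) (\<alpha> t) * (deriv \<beta> t)^2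
           + coeff_b (\<beta> t) (\<alpha> t) * deriv \<alpha> t * deriv \<beta> t
           + coeff_c (\<beta> t) (\<alpha> t) * (deriv \<alpha> t)^2 = 0)"
    using covariant_acceleration_fisher_rao_beta[OF T(1) _ T(2-5) pos]
    by (simp add: vec_eq_iff forall_2)
qed

end
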